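(* Let $q$ be a prime power, let $s \geq 3$ be an integer, and let $L(x_1,\ldots,x_s) = c_1x_1+\cdots+c_sx_s$ be a translation-invariant linear form of genus one over $\mathbb{F}_q$, with nonzero coefficients $c_i \in \mathbb{F}_q\setminus\{0\}$. Let \[d = (2^s-s-2)\bigl(1+2s(s-1)\bigr).\] Let $n\geq 1$ be an integer. If $A \subseteq \mathbb{F}_q^n$ is $L$-free, then, for every integer $r \geq 1$, there is an $L$-free set $B \subseteq \mathbb{F}_q^{dnr}$ of size \[|B| = r|A|^{d(r-1)}.\]
   Context: $\mathbb{F}_q$ is the finite field with $q$ elements and $[s]=\{1,\ldots,s\}$. The linear form $L(x_1,\ldots,x_s)=c_1x_1+\cdots+c_sx_s$ over $\mathbb{F}_q$ (all $c_i\neq 0$) is translation-invariant if $c_1+\cdots+c_s=0$. A translation-invariant $L$ has genus one if $\sum_{i\in I}c_i\neq 0$ for every nonempty proper subset $I\subsetneq [s]$. For such $L$ (translation-invariant of genus one), a set $S\subseteq \mathbb{F}_q^N$ is $L$-free if there are no solutions to $L(x_1,\ldots,x_s)=0$ with all $x_i\in S$, except for the trivial solutions where $x_1=\cdots=x_s$. *)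

theory Defs
  imports "Jordan_Normal_Form.Matrix"
begin

text \<open>The field with \<open>q\<close> elements is a type of sort \<open>{field, finite}\<close>, and its \<open>N\<close>-th power is
  \<open>carrier_vec N\<close>. A linear form in \<open>s\<close> variables is given by \<open>s\<close> and its coefficients
  \<open>c 1, \<dots>, c s\<close>; the values of \<open>c\<close> outside \<open>{1..s}\<close> are irrelevant.\<close>

text \<open>The value of the form at vectors \<open>x 1, \<dots>, x s\<close>, all in \<open>carrier_vec N\<close>.\<close>

definition lin_form :: "nat \<Rightarrow> nat \<Rightarrow> (nat \<Rightarrow> 'a::field) \<Rightarrow> (nat \<Rightarrow> 'a vec) \<Rightarrow> 'a vec" where
  "lin_form N s c x = finsum_vec TYPE('a) N (\<lambda>i. c i \<cdot>\<^sub>v x i) {1..s}"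

definition translation_invariant :: "nat \<Rightarrow> (nat \<Rightarrow> 'a::field) \<Rightarrow> bool" where
  "translation_invariant s c \<longleftrightarrow> (\<Sum>i\<in>{1..s}. c i) = 0"

definition genus_one :: "nat \<Rightarrow> (nat \<Rightarrow> 'a::field) \<Rightarrow> bool" where
  "genus_one s c \<longleftrightarrow> (\<forall>I. I \<noteq> {} \<and> I \<subset> {1..s} \<longrightarrow> (\<Sum>i\<in>I. c i) \<noteq> 0)"

text \<open>This notion of triviality of a solution is the appropriate one only for
  translation-invariant forms of genus one.\<close>

definition L_free :: "nat \<Rightarrow> nat \<Rightarrow> (nat \<Rightarrow> 'a::field) \<Rightarrow> 'a vec set \<Rightarrow> bool" where
  "L_free N s c S \<longleftrightarrow> S \<subseteq> carrier_vec N \<and>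
     (\<forall>x. (\<forall>i\<in>{1..s}. x i \<in> S) \<and> lin_form N s c x = 0\<^sub>v N
        \<longrightarrow> (\<forall>i\<in>{1..s}. \<forall>j\<in>{1..s}. x i = x j))"

end

theory Submission
  imports Defs
begin

text \<open>
  Suppose that in dimension \<open>D = d n\<close> there are L-free sets \<open>T\<close> and \<open>T'\<close>, both with \<open>card A ^ d\<close> elements,
  and a point \<open>v\<close>. For each \<open>p \<le> r\<close> consider the product of \<open>r\<close> factors that are \<open>{v}\<close> at position \<open>p\<close>, \<open>T'\<close>
  before \<open>p\<close> and \<open>T\<close> after \<open>p\<close>. The union \<open>B\<close> of these products has \<open>r * card A ^ (d * (r - 1))\<close> elements.
  Within one product every solution is trivial. A solution that uses several products assigns to every
  variable \<open>x i\<close> a position \<open>p i\<close>, not all of them equal, and it is excluded as soon as one position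
  is impossible. If some position is assigned to at least two variables, then at that position they all
  equal \<open>v\<close>, while the others lie in \<open>T \<union> T'\<close>. If the \<open>s \<ge> 3\<close> positions are pairwise
  distinct, then at the second largest of them one entry equals \<open>v\<close>, one lies in \<open>T'\<close>, and the rest lie
  in \<open>T\<close>. So it is enough that the equation has no solution of these two kinds
  (\<open>patterns\<close>); this reduction is \<open>L_free_words\<close>.

  Such triples are products of small ones, each of which excludes the patterns with a given \<open>I\<close>, or a
  single pattern. Let \<open>a0 \<noteq> a1\<close> be in
  \<open>A\<close>, and let \<open>I\<close> be the set of indices at which the entry is \<open>v\<close>.

  If \<open>2 \<le> card I < s\<close>, take \<open>T = T' = A\<close> and let \<open>v\<close> be a weighted mean, with weights \<open>c i\<close> for \<open>i \<in> I\<close>, of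
  non-constant elements of \<open>A\<close>; a solution would yield a nontrivial solution in \<open>A\<close>
  (\<open>has_triple_many_special\<close>).

  If \<open>I = {i}\<close> and \<open>T'\<close> is used at \<open>k\<close> only, take two copies of the space, \<open>v = 0\<close>, and shear \<open>A \<times> A\<close> in
  two ways: \<open>T\<close> consists of the points \<open>(x, y + g x)\<close> and \<open>T'\<close> of the points \<open>(x + h y, y)\<close>. Here \<open>g\<close> is
  a scalar, and \<open>h y\<close> is a multiple of \<open>e y\<close> for a fixed-point free map \<open>e\<close> on \<open>A\<close>. The first copy forces all
  \<open>x\<close> to equal \<open>e (y k)\<close>, and then the second one forces \<open>y k = e (y k)\<close>
  (\<open>has_triple_one_special\<close>).

  This needs \<open>2 ^ s - s - 2\<close> copies for the first kind and \<open>2 * s * (s - 1)\<close> for the second,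
  which is at most \<open>d\<close>. If \<open>A\<close> has at most one element, a single copy with \<open>v \<notin> A\<close> excludes every pattern.
\<close>

section \<open>The linear form on concatenated vectors\<close>

lemma index_lin_form:
  assumes "\<And>i. i \<in> {1..s} \<Longrightarrow> x i \<in> carrier_vec N" and "l < N"
  shows "lin_form N s c x $ l = (\<Sum>i\<in>{1..s}. c i * x i $ l)"
proof -
  have "lin_form N s c x $ l = (\<Sum>i\<in>{1..s}. (c i \<cdot>\<^sub>v x i) $ l)"
    unfolding lin_form_def using assms by (intro index_finsum_vec) auto
  also have "\<dots> = (\<Sum>i\<in>{1..s}. c i * x i $ l)"
  proof (intro sum.cong refl)
    fix i assume "i \<in> {1..s}"
    then have "dim_vec (x i) = N" by (intro carrier_vecD assms(1))
    then show "(c i \<cdot>\<^sub>v x i) $ l = c i * x i $ l" using assms(2) by simp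
  qed
  finally show ?thesis .
qed

lemma lin_form_carrier:
  assumes "\<And>i. i \<in> {1..s} \<Longrightarrow> x i \<in> carrier_vec N"
  shows "lin_form N s c x \<in> carrier_vec N"
  unfolding lin_form_def using assms by (intro finsum_vec_closed) auto

lemma lin_form_eq_0_iff:
  assumes "\<And>i. i \<in> {1..s} \<Longrightarrow> x i \<in> carrier_vec N"
  shows "lin_form N s c x = 0\<^sub>v N \<longleftrightarrow> (\<forall>l<N. (\<Sum>i\<in>{1..s}. c i * x i $ l) = 0)"
proof -
  have "lin_form N s c x = 0\<^sub>v N \<longleftrightarrow> (\<forall>l<N. lin_form N s c x $ l = 0)"
    using lin_form_carrier[OF assms] by (auto intro!: eq_vecI dest!: carrier_vecD)
  then show ?thesis
    using index_lin_form[OF assms] by auto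
qed

lemma lin_form_append_eq_0_iff:
  assumes "\<And>i. i \<in> {1..s} \<Longrightarrow> x i \<in> carrier_vec N"
    and "\<And>i. i \<in> {1..s} \<Longrightarrow> y i \<in> carrier_vec M"
  shows "lin_form (N + M) s c (\<lambda>i. x i @\<^sub>v y i) = 0\<^sub>v (N + M) \<longleftrightarrow>
    lin_form N s c x = 0\<^sub>v N \<and> lin_form M s c y = 0\<^sub>v M"
proof -
  have dim: "dim_vec (x i) = N" "dim_vec (y i) = M" if "i \<in> {1..s}" for i
    using assms that by (simp_all only: carrier_vecD)
  have left: "(\<Sum>i\<in>{1..s}. c i * (x i @\<^sub>v y i) $ l) = (\<Sum>i\<in>{1..s}. c i * x i $ l)" if "l < N" for l
    using that dim by (intro sum.cong) auto
  have right: "(\<Sum>i\<in>{1..s}. c i * (x i @\<^sub>v y i) $ (N + l)) = (\<Sum>i\<in>{1..s}. c i * y i $ l)" if "l < M" for l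
    using that dim by (intro sum.cong) auto
  have all_split: "(\<forall>l<N + M. Q l) \<longleftrightarrow> (\<forall>l<N. Q l) \<and> (\<forall>l<M. Q (N + l))" for Q
    by (metis add_diff_inverse_nat add_less_cancel_left trans_less_add1)
  have "lin_form (N + M) s c (\<lambda>i. x i @\<^sub>v y i) = 0\<^sub>v (N + M) \<longleftrightarrow>
      (\<forall>l<N + M. (\<Sum>i\<in>{1..s}. c i * (x i @\<^sub>v y i) $ l) = 0)"
    using assms by (intro lin_form_eq_0_iff append_carrier_vec)
  also have "\<dots> \<longleftrightarrow> (\<forall>l<N. (\<Sum>i\<in>{1..s}. c i * x i $ l) = 0) \<and>
      (\<forall>l<M. (\<Sum>i\<in>{1..s}. c i * y i $ l) = 0)"
    unfolding all_split using left right by simp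
  also have "\<dots> \<longleftrightarrow> lin_form N s c x = 0\<^sub>v N \<and> lin_form M s c y = 0\<^sub>v M"
    using lin_form_eq_0_iff[of s x N c] lin_form_eq_0_iff[of s y M c] assms by simp
  finally show ?thesis .
qed

lemma lin_form_eq_0_cong:
  assumes "\<And>i. i \<in> {1..s} \<Longrightarrow> x i \<in> carrier_vec N"
    and "\<And>i. i \<in> {1..s} \<Longrightarrow> y i \<in> carrier_vec N"
    and "\<And>l. l < N \<Longrightarrow> (\<Sum>i\<in>{1..s}. c i * x i $ l) = (\<Sum>i\<in>{1..s}. c i * y i $ l)"
  shows "lin_form N s c x = 0\<^sub>v N \<longleftrightarrow> lin_form N s c y = 0\<^sub>v N"
proof -
  have "lin_form N s c x = 0\<^sub>v N \<longleftrightarrow> (\<forall>l<N. (\<Sum>i\<in>{1..s}. c i * x i $ l) = 0)"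
    by (intro lin_form_eq_0_iff assms(1))
  moreover have "lin_form N s c y = 0\<^sub>v N \<longleftrightarrow> (\<forall>l<N. (\<Sum>i\<in>{1..s}. c i * y i $ l) = 0)"
    by (intro lin_form_eq_0_iff assms(2))
  ultimately show ?thesis
    by (simp only: assms(3) cong: imp_cong)
qed

lemma lin_form_append_eq_0D:
  assumes yc: "\<And>i. i \<in> {1..s} \<Longrightarrow> y i \<in> carrier_vec N"
    and zc: "\<And>i. i \<in> {1..s} \<Longrightarrow> z i \<in> carrier_vec M"
    and xyz: "\<And>i. i \<in> {1..s} \<Longrightarrow> x i = y i @\<^sub>v z i"
    and L: "lin_form (N + M) s c x = 0\<^sub>v (N + M)"
  shows "lin_form N s c y = 0\<^sub>v N" "lin_form M s c z = 0\<^sub>v M"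
proof -
  have yzc: "y i @\<^sub>v z i \<in> carrier_vec (N + M)" if "i \<in> {1..s}" for i
    using yc[OF that] zc[OF that] by simp
  have xc: "x i \<in> carrier_vec (N + M)" if "i \<in> {1..s}" for i
    using yzc[OF that] xyz[OF that] by simp
  have "(\<Sum>i\<in>{1..s}. c i * (y i @\<^sub>v z i) $ l) = (\<Sum>i\<in>{1..s}. c i * x i $ l)" for l
    by (intro sum.cong refl) (simp only: xyz)
  then have "lin_form (N + M) s c (\<lambda>i. y i @\<^sub>v z i) = 0\<^sub>v (N + M)"
    using lin_form_eq_0_cong[of s "\<lambda>i. y i @\<^sub>v z i" "N + M" x c] yzc xc L by presburger
  then show "lin_form N s c y = 0\<^sub>v N" "lin_form M s c z = 0\<^sub>v M"
    using lin_form_append_eq_0_iff[of s y N z M c] yc zc by presburger+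
qed

text \<open>The Cartesian product of two sets of vectors, realised by concatenation.\<close>

definition vec_prod :: "'a vec set \<Rightarrow> 'a vec set \<Rightarrow> 'a vec set" where
  "vec_prod S S' = (\<lambda>(x, y). x @\<^sub>v y) ` (S \<times> S')"

lemma vec_prod_carrier:
  "S \<subseteq> carrier_vec N \<Longrightarrow> S' \<subseteq> carrier_vec M \<Longrightarrow> vec_prod S S' \<subseteq> carrier_vec (N + M)"
  by (auto simp: vec_prod_def)

lemma finite_vec_prod: "finite S \<Longrightarrow> finite S' \<Longrightarrow> finite (vec_prod S S')"
  by (simp add: vec_prod_def)

lemma card_vec_prod:
  assumes "S \<subseteq> carrier_vec N"
  shows "card (vec_prod S S') = card S * card S'"
proof -
  have "inj_on (\<lambda>(x, y). x @\<^sub>v y) (S \<times> S')"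
  proof (rule inj_onI)
    fix p p'
    assume p: "p \<in> S \<times> S'" "p' \<in> S \<times> S'"
      and eq: "(case p of (x, y) \<Rightarrow> x @\<^sub>v y) = (case p' of (x, y) \<Rightarrow> x @\<^sub>v y)"
    have "fst p \<in> carrier_vec N" "fst p' \<in> carrier_vec N" using p assms by auto
    from append_vec_eq[OF this, of "snd p" "snd p'"] eq show "p = p'"
      by (simp add: case_prod_beta prod_eq_iff)
  qed
  then show ?thesis
    by (simp add: vec_prod_def card_image card_cartesian_product)
qed


text \<open>A solution in a tuple of products consists of a solution in each factor.\<close>

lemma vec_prod_solution:
  assumes S: "\<And>i. i \<in> {1..s} \<Longrightarrow> S i \<subseteq> carrier_vec N"
    and S': "\<And>i. i \<in> {1..s} \<Longrightarrow> S' i \<subseteq> carrier_vec M"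
    and x: "\<forall>i\<in>{1..s}. x i \<in> vec_prod (S i) (S' i)"
    and L: "lin_form (N + M) s c x = 0\<^sub>v (N + M)"
  obtains y z where "\<forall>i\<in>{1..s}. y i \<in> S i \<and> z i \<in> S' i \<and> x i = y i @\<^sub>v z i"
    "lin_form N s c y = 0\<^sub>v N" "lin_form M s c z = 0\<^sub>v M"
proof -
  have "\<forall>i\<in>{1..s}. \<exists>p. fst p \<in> S i \<and> snd p \<in> S' i \<and> x i = fst p @\<^sub>v snd p"
    using x by (force simp: vec_prod_def)
  then obtain f where
    f: "\<forall>i\<in>{1..s}. fst (f i) \<in> S i \<and> snd (f i) \<in> S' i \<and> x i = fst (f i) @\<^sub>v snd (f i)"
    by metis
  define y where "y = fst \<circ> f"
  define z where "z = snd \<circ> f"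
  have y: "y i \<in> S i" and z: "z i \<in> S' i" and xyz: "x i = y i @\<^sub>v z i" if "i \<in> {1..s}" for i
    using bspec[OF f that] by (auto simp: y_def z_def)
  have yc: "y i \<in> carrier_vec N" and zc: "z i \<in> carrier_vec M" if "i \<in> {1..s}" for i
    using y[OF that] z[OF that] S[OF that] S'[OF that] by auto
  have "lin_form N s c y = 0\<^sub>v N \<and> lin_form M s c z = 0\<^sub>v M"
    using lin_form_append_eq_0D[OF yc zc xyz L] by blast
  then show ?thesis
    using that[of y z] y z xyz by blast
qed

section \<open>L-free sets and excluded tuples of sets\<close>

lemma L_free_carrier: "L_free N s c S \<Longrightarrow> S \<subseteq> carrier_vec N"
  by (simp add: L_free_def)

lemma L_freeD:
  assumes "L_free N s c S" "\<And>i. i \<in> {1..s} \<Longrightarrow> x i \<in> S" "lin_form N s c x = 0\<^sub>v N"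
    "i \<in> {1..s}" "j \<in> {1..s}"
  shows "x i = x j"
  using assms unfolding L_free_def by blast

lemma L_freeI:
  assumes "S \<subseteq> carrier_vec N"
    and "\<And>x i j. \<forall>i\<in>{1..s}. x i \<in> S \<Longrightarrow> lin_form N s c x = 0\<^sub>v N \<Longrightarrow>
      i \<in> {1..s} \<Longrightarrow> j \<in> {1..s} \<Longrightarrow> x i = x j"
  shows "L_free N s c S"
  using assms by (simp add: L_free_def)

lemma L_free_vec_prod:
  assumes S: "L_free N s c S" and S': "L_free M s c S'"
  shows "L_free (N + M) s c (vec_prod S S')"
proof (rule L_freeI)
  show "vec_prod S S' \<subseteq> carrier_vec (N + M)"
    using assms by (intro vec_prod_carrier L_free_carrier)
next
  fix x i j
  assume x: "\<forall>i\<in>{1..s}. x i \<in> vec_prod S S'" and L: "lin_form (N + M) s c x = 0\<^sub>v (N + M)"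
    and i: "i \<in> {1..s}" and j: "j \<in> {1..s}"
  obtain y z where *: "\<forall>i\<in>{1..s}. y i \<in> S \<and> z i \<in> S' \<and> x i = y i @\<^sub>v z i"
    and L': "lin_form N s c y = 0\<^sub>v N" "lin_form M s c z = 0\<^sub>v M"
    by (rule vec_prod_solution[OF L_free_carrier[OF S] L_free_carrier[OF S'] x L])
  have yz: "y i \<in> S" "z i \<in> S'" "x i = y i @\<^sub>v z i" if "i \<in> {1..s}" for i
    using bspec[OF * that] by blast+
  have "y i = y j" by (rule L_freeD[OF S yz(1) L'(1) i j])
  moreover have "z i = z j" by (rule L_freeD[OF S' yz(2) L'(2) i j])
  ultimately show "x i = x j" by (simp only: yz(3)[OF i] yz(3)[OF j])
qed

text \<open>The equation has no solution whose \<open>i\<close>-th entry lies in \<open>S i\<close> for all \<open>i\<close>.\<close>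

definition avoids :: "nat \<Rightarrow> nat \<Rightarrow> (nat \<Rightarrow> 'a::field) \<Rightarrow> (nat \<Rightarrow> 'a vec set) \<Rightarrow> bool" where
  "avoids N s c S \<longleftrightarrow> (\<forall>x. (\<forall>i\<in>{1..s}. x i \<in> S i) \<longrightarrow> lin_form N s c x \<noteq> 0\<^sub>v N)"

lemma avoidsD:
  "(\<And>i. i \<in> {1..s} \<Longrightarrow> x i \<in> S i) \<Longrightarrow> avoids N s c S \<Longrightarrow> lin_form N s c x = 0\<^sub>v N \<Longrightarrow> False"
  by (auto simp: avoids_def)

text \<open>A tuple of products is excluded as soon as one of the two factors is.\<close>

lemma avoids_vec_prod:
  assumes "\<And>i. i \<in> {1..s} \<Longrightarrow> S i \<subseteq> carrier_vec N"
    and "\<And>i. i \<in> {1..s} \<Longrightarrow> S' i \<subseteq> carrier_vec M"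
    and "avoids N s c S \<or> avoids M s c S'"
  shows "avoids (N + M) s c (\<lambda>i. vec_prod (S i) (S' i))"
  unfolding avoids_def
proof (intro allI impI notI)
  fix x
  assume x: "\<forall>i\<in>{1..s}. x i \<in> vec_prod (S i) (S' i)" and L: "lin_form (N + M) s c x = 0\<^sub>v (N + M)"
  obtain y z where "\<forall>i\<in>{1..s}. y i \<in> S i \<and> z i \<in> S' i \<and> x i = y i @\<^sub>v z i"
    "lin_form N s c y = 0\<^sub>v N" "lin_form M s c z = 0\<^sub>v M"
    by (rule vec_prod_solution[OF assms(1,2) x L])
  then show False
    using assms(3) avoidsD[of s y S] avoidsD[of s z S'] by blast
qed

text \<open>A pattern \<open>(I, K)\<close> is encoded as the tuple of sets with \<open>{v}\<close> at the indices in \<open>I\<close>, \<open>T'\<close> at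
  the remaining indices in \<open>K\<close>, and \<open>T\<close> elsewhere.\<close>

definition slots :: "'a vec set \<Rightarrow> 'a vec set \<Rightarrow> 'a vec \<Rightarrow> nat set \<Rightarrow> nat set \<Rightarrow> nat \<Rightarrow> 'a vec set" where
  "slots T T' v I K i = (if i \<in> I then {v} else if i \<in> K then T' else T)"

text \<open>The patterns that have to be excluded. In the first kind \<open>K\<close> is arbitrary, since it does not
  matter which of the remaining entries lie in \<open>T\<close> and which in \<open>T'\<close>.\<close>

definition patterns :: "nat \<Rightarrow> (nat set \<times> nat set) set" where
  "patterns s = {(I, K). I \<subseteq> {1..s} \<and> 2 \<le> card I \<and> card I < s} \<union>
     {({i}, {k}) | i k. i \<in> {1..s} \<and> k \<in> {1..s} \<and> i \<noteq> k}"

section \<open>Unions of products built from one triple\<close>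

text \<open>The set \<open>head_words T' r\<close> is the \<open>r\<close>-th power of \<open>T'\<close>: the part, within the first \<open>r\<close> factors, of
  the words whose \<open>v\<close> comes later. The set \<open>words T T' v r\<close> is the union, over the
  positions \<open>p \<le> r\<close>, of the products of \<open>r\<close> factors that are \<open>{v}\<close> at position \<open>p\<close>, \<open>T'\<close> before
  and \<open>T\<close> after it.\<close>

primrec head_words :: "'a::zero vec set \<Rightarrow> nat \<Rightarrow> 'a vec set" where
  "head_words T' 0 = {0\<^sub>v 0}"
| "head_words T' (Suc r) = vec_prod (head_words T' r) T'"

primrec words :: "'a::zero vec set \<Rightarrow> 'a vec set \<Rightarrow> 'a vec \<Rightarrow> nat \<Rightarrow> 'a vec set" where
  "words T T' v 0 = {}"
| "words T T' v (Suc r) = vec_prod (words T T' v r) T \<union> vec_prod (head_words T' r) {v}"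

text \<open>A translation-invariant linear form of genus one in at least three variables.\<close>

locale genus_one_form =
  fixes s :: nat and c :: "nat \<Rightarrow> 'a::field"
  assumes s_ge_3: "3 \<le> s"
    and coeff_nonzero: "\<And>i. i \<in> {1..s} \<Longrightarrow> c i \<noteq> 0"
    and invariant: "translation_invariant s c"
    and genus: "genus_one s c"
begin

lemma sum_coeff: "(\<Sum>i\<in>{1..s}. c i) = 0"
  using invariant by (simp add: translation_invariant_def)

lemma sum_coeff_nonzero: "I \<subset> {1..s} \<Longrightarrow> I \<noteq> {} \<Longrightarrow> (\<Sum>i\<in>I. c i) \<noteq> 0"
  using genus by (auto simp: genus_one_def)

lemma lin_form_const:
  assumes "\<And>i. i \<in> {1..s} \<Longrightarrow> x i = u" "u \<in> carrier_vec N"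
  shows "lin_form N s c x = 0\<^sub>v N"
proof -
  have "(\<Sum>i\<in>{1..s}. c i * x i $ l) = 0" for l
  proof -
    have "(\<Sum>i\<in>{1..s}. c i * x i $ l) = (\<Sum>i\<in>{1..s}. c i) * u $ l"
      unfolding sum_distrib_right using assms(1) by (intro sum.cong refl) (simp only:)
    then show ?thesis by (simp only: sum_coeff mult_zero_left)
  qed
  moreover have "x i \<in> carrier_vec N" if "i \<in> {1..s}" for i
    using assms(2) by (simp only: assms(1)[OF that])
  ultimately show ?thesis
    using lin_form_eq_0_iff[of s x N c] by presburger
qed

end

text \<open>Two L-free sets and a point that exclude every pattern in \<open>patterns s\<close>.\<close>

locale special_triple = genus_one_form s c for s and c :: "nat \<Rightarrow> 'a::field" +
  fixes D :: nat and T T' :: "'a vec set" and v :: "'a vec"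
  assumes T: "L_free D s c T" and T': "L_free D s c T'" and v: "v \<in> carrier_vec D"
    and excluded: "\<And>I K. (I, K) \<in> patterns s \<Longrightarrow> avoids D s c (slots T T' v I K)"
begin

lemmas T_carrier = L_free_carrier[OF T]
lemmas T'_carrier = L_free_carrier[OF T']

lemma v_notin_T: "v \<notin> T"
proof
  \<comment> \<open>Otherwise the constant solution \<open>v\<close> fits any pattern with empty \<open>K\<close>.\<close>
  assume "v \<in> T"
  have "avoids D s c (slots T T' v {1,2} {})"
    using s_ge_3 by (intro excluded) (auto simp: patterns_def)
  moreover have "lin_form D s c (\<lambda>_. v) = 0\<^sub>v D"
    using v by (intro lin_form_const) auto
  ultimately show False
    using \<open>v \<in> T\<close> by (force simp: avoids_def slots_def)
qed

lemma Suc_mult_D: "Suc r * D = r * D + D"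
  by simp

lemma head_words_carrier: "head_words T' r \<subseteq> carrier_vec (r * D)"
proof (induction r)
  case (Suc r)
  then show ?case
    unfolding head_words.simps Suc_mult_D by (intro vec_prod_carrier T'_carrier)
qed simp

lemma words_carrier: "words T T' v r \<subseteq> carrier_vec (r * D)"
proof (induction r)
  case (Suc r)
  then show ?case
    unfolding words.simps Suc_mult_D using v
    by (intro Un_least vec_prod_carrier T_carrier head_words_carrier) auto
qed simp

lemma card_head_words: "card (head_words T' r) = card T' ^ r"
  by (induction r) (simp_all add: card_vec_prod[OF head_words_carrier])

lemma card_words:
  assumes "finite T" "finite T'" "card T = k" "card T' = k"
  shows "card (words T T' v r) = r * k ^ (r - 1)"
proof (induction r)
  case (Suc r)
  have fin_head: "finite (head_words T' r)" for r
    by (induction r) (simp_all add: finite_vec_prod assms)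
  have fin: "finite (words T T' v r)" for r
    by (induction r) (simp_all add: finite_vec_prod fin_head assms)
  have "vec_prod (words T T' v r) T \<inter> vec_prod (head_words T' r) {v} = {}"
    using v_notin_T words_carrier[of r] head_words_carrier[of r]
    by (force simp: vec_prod_def)
  then have "card (words T T' v (Suc r)) =
      card (vec_prod (words T T' v r) T) + card (vec_prod (head_words T' r) {v})"
    by (simp add: card_Un_disjoint finite_vec_prod fin fin_head assms)
  also have "\<dots> = r * k ^ (r - 1) * k + k ^ r"
    by (simp add: card_vec_prod[OF head_words_carrier] card_vec_prod[OF words_carrier]
        card_head_words Suc assms)
  also have "\<dots> = Suc r * k ^ (Suc r - 1)"
    by (cases r) (auto simp: algebra_simps)
  finally show ?case .
qed simp

lemma L_free_head_words: "L_free (r * D) s c (head_words T' r)"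
proof (induction r)
  case (Suc r)
  then show ?case
    unfolding head_words.simps Suc_mult_D by (intro L_free_vec_prod T')
qed (simp add: L_free_def)

text \<open>This is the case of one variable whose \<open>v\<close> comes after the first \<open>r\<close> positions, where the other
  variables have theirs. At the last of these positions that variable has its entry in \<open>T'\<close>, and
  the others have entries in \<open>T\<close> or equal to \<open>v\<close>. If at least one of them equals \<open>v\<close>, the pattern is
  excluded; if none does, the last position can be dropped.\<close>

lemma avoids_one_head_word:
  assumes i: "i \<in> {1..s}"
  shows "avoids (r * D) s c (\<lambda>j. if j = i then head_words T' r else words T T' v r)"
proof (induction r)
  case 0
  define j where "j = (if i = 1 then 2 else 1 :: nat)"
  have "j \<in> {1..s}" "j \<noteq> i"
    using s_ge_3 by (auto simp: j_def)
  then show ?case unfolding avoids_def by (metis empty_iff words.simps(1))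
next
  case (Suc r)
  have "avoids (r * D + D) s c (\<lambda>j. if j = i then head_words T' (Suc r) else words T T' v (Suc r))"
    unfolding avoids_def
  proof (intro allI impI notI)
    fix x
    assume x: "\<forall>j\<in>{1..s}. x j \<in> (if j = i then head_words T' (Suc r) else words T T' v (Suc r))"
      and L: "lin_form (r * D + D) s c x = 0\<^sub>v (r * D + D)"
    define I where "I = {j \<in> {1..s} - {i}. x j \<in> vec_prod (head_words T' r) {v}}"
    define S where "S = (\<lambda>j. if j = i \<or> j \<in> I then head_words T' r else words T T' v r)"
    have I: "I \<subseteq> {1..s} - {i}" by (auto simp: I_def)
    then have "card I \<le> card ({1..s} - {i})"
      by (intro card_mono) auto
    then have card_I: "card I < s" using s_ge_3 i by auto
    have fin: "finite I" using I finite_subset by blast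
    have "x j \<in> vec_prod (S j) (slots T T' v I {i} j)" if "j \<in> {1..s}" for j
    proof -
      consider "j = i" | "j \<noteq> i" "j \<in> I" | "j \<noteq> i" "j \<notin> I" by blast
      then show ?thesis
      proof cases
        case 1
        then have "x j \<in> vec_prod (head_words T' r) T'" "j \<notin> I"
          using bspec[OF x that] I by auto
        then show ?thesis using 1 by (simp add: S_def slots_def)
      next
        case 2
        then have "x j \<in> vec_prod (head_words T' r) {v}" by (simp add: I_def)
        then show ?thesis using 2 by (simp add: S_def slots_def)
      next
        case 3
        then have "x j \<in> vec_prod (words T T' v r) T"
          using bspec[OF x that] that by (simp add: I_def)
        then show ?thesis using 3 by (simp add: S_def slots_def)
      qed
    qed
    moreover have "avoids (r * D + D) s c (\<lambda>j. vec_prod (S j) (slots T T' v I {i} j))"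
    proof (intro avoids_vec_prod)
      show "S j \<subseteq> carrier_vec (r * D)" for j
        using head_words_carrier words_carrier by (auto simp: S_def)
      show "slots T T' v I {i} j \<subseteq> carrier_vec D" for j
        using T_carrier T'_carrier v by (auto simp: slots_def)
      consider "card I = 0" | "card I = 1" | "card I \<ge> 2" by linarith
      then show "avoids (r * D) s c S \<or> avoids D s c (slots T T' v I {i})"
      proof cases
        case 1
        then have "I = {}" using fin by simp
        then show ?thesis using Suc by (simp add: S_def)
      next
        case 2
        then obtain i' where "I = {i'}" by (auto simp: card_1_singleton_iff)
        then have "(I, {i}) \<in> patterns s" using I i by (auto simp: patterns_def)
        then show ?thesis by (intro disjI2 excluded)
      next
        case 3
        then have "(I, {i}) \<in> patterns s" using I card_I by (auto simp: patterns_def)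
        then show ?thesis by (intro disjI2 excluded)
      qed
    qed
    ultimately show False using L by (rule avoidsD)
  qed
  then show ?case unfolding Suc_mult_D .
qed

text \<open>Induction on \<open>r\<close>: let \<open>I\<close> be the set of variables with \<open>v\<close> at the last position. All variables or
  none being in \<open>I\<close> reduces to an L-free product, one being in \<open>I\<close> is the previous lemma, and every other size
  of \<open>I\<close> is an excluded pattern.\<close>

lemma L_free_words: "L_free (r * D) s c (words T T' v r)"
proof (induction r)
  case 0
  have "1 \<in> {1..s}" using s_ge_3 by simp
  then show ?case unfolding L_free_def words.simps by blast
next
  case (Suc r)
  have "x a = x b"
    if x: "\<forall>j\<in>{1..s}. x j \<in> words T T' v (Suc r)"
      and L: "lin_form (r * D + D) s c x = 0\<^sub>v (r * D + D)"
      and ab: "a \<in> {1..s}" "b \<in> {1..s}" for x a b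
  proof -
    define I where "I = {j \<in> {1..s}. x j \<in> vec_prod (head_words T' r) {v}}"
    define S where "S = (\<lambda>j. if j \<in> I then head_words T' r else words T T' v r)"
    have I: "I \<subseteq> {1..s}" by (auto simp: I_def)
    have fin: "finite I" using I finite_subset by blast
    have card_I: "card I \<le> s" using card_mono[OF _ I] by simp
    have x_slots: "x j \<in> vec_prod (S j) (slots T T' v I {} j)" if "j \<in> {1..s}" for j
      using x that I by (auto simp: S_def slots_def I_def)
    have not_avoids: "\<not> avoids (r * D + D) s c (\<lambda>j. vec_prod (S j) (slots T T' v I {} j))"
    proof
      assume "avoids (r * D + D) s c (\<lambda>j. vec_prod (S j) (slots T T' v I {} j))"
      from avoidsD[OF x_slots this L] show False .
    qed
    have "\<not> (avoids (r * D) s c S \<or> avoids D s c (slots T T' v I {}))"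
    proof
      assume "avoids (r * D) s c S \<or> avoids D s c (slots T T' v I {})"
      moreover have "S j \<subseteq> carrier_vec (r * D)" for j
        using head_words_carrier words_carrier by (auto simp: S_def)
      moreover have "slots T T' v I {} j \<subseteq> carrier_vec D" for j
        using T_carrier T'_carrier v by (auto simp: slots_def)
      ultimately have "avoids (r * D + D) s c (\<lambda>j. vec_prod (S j) (slots T T' v I {} j))"
        using avoids_vec_prod[of s S "r * D" "slots T T' v I {}" D c] by blast
      then show False using not_avoids by simp
    qed
    then have S: "\<not> avoids (r * D) s c S" and slots: "\<not> avoids D s c (slots T T' v I {})"
      by auto
    have "(I, {}) \<notin> patterns s" using slots excluded by blast
    then have "card I = 0 \<or> card I = 1 \<or> card I = s"
      using I card_I by (auto simp: patterns_def)
    moreover have "card I \<noteq> 1"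
    proof
      assume "card I = 1"
      then obtain i where "I = {i}" by (auto simp: card_1_singleton_iff)
      then show False
        using S I avoids_one_head_word[of i r] unfolding S_def by simp
    qed
    moreover have "I = {1..s}" if "card I = s"
      using card_subset_eq[OF _ I] that by simp
    moreover have "I = {}" if "card I = 0"
      using that fin by simp
    ultimately consider "I = {}" | "I = {1..s}"
      by blast
    then show ?thesis
    proof cases
      case 1
      then have "\<forall>j\<in>{1..s}. x j \<in> vec_prod (words T T' v r) T"
        using x by (auto simp: I_def)
      then show ?thesis
        using L_freeD[OF L_free_vec_prod[OF Suc T] _ L ab] by simp
    next
      case 2
      have "L_free D s c {v}" using v by (auto simp: L_free_def)
      moreover have "\<forall>j\<in>{1..s}. x j \<in> vec_prod (head_words T' r) {v}"
        using 2 by (auto simp: I_def)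
      ultimately show ?thesis
        using L_freeD[OF L_free_vec_prod[OF L_free_head_words] _ L ab] by simp
    qed
  qed
  then show ?case
    using words_carrier[of "Suc r"] unfolding Suc_mult_D by (intro L_freeI) blast+
qed

end

section \<open>Triples that exclude prescribed patterns\<close>

context genus_one_form
begin

lemma L_free_singleton: "u \<in> carrier_vec N \<Longrightarrow> L_free N s c {u}"
  by (auto simp: L_free_def)

text \<open>In \<open>m\<close> copies of the \<open>n\<close>-dimensional space there are L-free sets of the size of the \<open>m\<close>-th power of
  \<open>A\<close> and a point that exclude every pattern in \<open>\<Phi>\<close>. The set \<open>A\<close> enters through its cardinality only.\<close>

definition has_triple :: "nat \<Rightarrow> 'a vec set \<Rightarrow> nat \<Rightarrow> (nat set \<times> nat set) set \<Rightarrow> bool" where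
  "has_triple n A m \<Phi> \<longleftrightarrow> (\<exists>T T' v. L_free (m * n) s c T \<and> L_free (m * n) s c T' \<and>
     finite T \<and> finite T' \<and> card T = card A ^ m \<and> card T' = card A ^ m \<and> v \<in> carrier_vec (m * n) \<and>
     (\<forall>(I, K)\<in>\<Phi>. avoids (m * n) s c (slots T T' v I K)))"

lemma has_tripleI:
  assumes "L_free (m * n) s c T" "L_free (m * n) s c T'" "finite T" "finite T'"
    "card T = card A ^ m" "card T' = card A ^ m" "v \<in> carrier_vec (m * n)"
    "\<And>I K. (I, K) \<in> \<Phi> \<Longrightarrow> avoids (m * n) s c (slots T T' v I K)"
  shows "has_triple n A m \<Phi>"
  unfolding has_triple_def using assms by (intro exI[of _ T] exI[of _ T'] exI[of _ v]) auto

lemma has_tripleE: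
  assumes "has_triple n A m \<Phi>"
  obtains T T' v where "L_free (m * n) s c T" "L_free (m * n) s c T'" "finite T" "finite T'"
    "card T = card A ^ m" "card T' = card A ^ m" "v \<in> carrier_vec (m * n)"
    "\<And>I K. (I, K) \<in> \<Phi> \<Longrightarrow> avoids (m * n) s c (slots T T' v I K)"
  using assms unfolding has_triple_def by fast

lemma has_triple_Un:
  assumes 1: "has_triple n A m \<Phi>" and 2: "has_triple n A m' \<Phi>'"
  shows "has_triple n A (m + m') (\<Phi> \<union> \<Phi>')"
proof -
  from 1 obtain T T' v where T: "L_free (m * n) s c T" "L_free (m * n) s c T'" "finite T" "finite T'"
    "card T = card A ^ m" "card T' = card A ^ m" "v \<in> carrier_vec (m * n)"
    and excl: "\<And>I K. (I, K) \<in> \<Phi> \<Longrightarrow> avoids (m * n) s c (slots T T' v I K)"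
    by (rule has_tripleE) blast
  from 2 obtain U U' w where U: "L_free (m' * n) s c U" "L_free (m' * n) s c U'" "finite U" "finite U'"
    "card U = card A ^ m'" "card U' = card A ^ m'" "w \<in> carrier_vec (m' * n)"
    and excl': "\<And>I K. (I, K) \<in> \<Phi>' \<Longrightarrow> avoids (m' * n) s c (slots U U' w I K)"
    by (rule has_tripleE) blast
  note Tc = L_free_carrier[OF T(1)] L_free_carrier[OF T(2)]
  note Uc = L_free_carrier[OF U(1)] L_free_carrier[OF U(2)]
  have slots: "slots (vec_prod T U) (vec_prod T' U') (v @\<^sub>v w) I K =
      (\<lambda>i. vec_prod (slots T T' v I K i) (slots U U' w I K i))" for I K
    by (auto simp: slots_def vec_prod_def fun_eq_iff)
  have carrier: "slots T T' v I K i \<subseteq> carrier_vec (m * n)"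
    "slots U U' w I K i \<subseteq> carrier_vec (m' * n)" for I K i
    using Tc Uc T(7) U(7) by (auto simp: slots_def)
  have dim: "(m + m') * n = m * n + m' * n" by (simp add: add_mult_distrib)
  show ?thesis
  proof (rule has_tripleI[of _ _ "vec_prod T U" "vec_prod T' U'" _ "v @\<^sub>v w"])
    show "L_free ((m + m') * n) s c (vec_prod T U)" "L_free ((m + m') * n) s c (vec_prod T' U')"
      unfolding dim by (intro L_free_vec_prod T U)+
    show "v @\<^sub>v w \<in> carrier_vec ((m + m') * n)"
      unfolding dim using T(7) U(7) by simp
    show "card (vec_prod T U) = card A ^ (m + m')" "card (vec_prod T' U') = card A ^ (m + m')"
      using card_vec_prod[OF Tc(1)] card_vec_prod[OF Tc(2)] T U by (simp_all add: power_add)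
    show "avoids ((m + m') * n) s c (slots (vec_prod T U) (vec_prod T' U') (v @\<^sub>v w) I K)"
      if "(I, K) \<in> \<Phi> \<union> \<Phi>'" for I K
      unfolding dim slots using that excl excl' carrier by (intro avoids_vec_prod) blast+
  qed (intro finite_vec_prod T U)+
qed

lemma has_triple_UNION:
  assumes "finite E" "\<And>e. e \<in> E \<Longrightarrow> has_triple n A w (\<Phi> e)"
  shows "has_triple n A (w * card E) (\<Union>e\<in>E. \<Phi> e)"
  using assms
proof (induction E)
  case empty
  show ?case
    by (rule has_tripleI[of _ _ "{0\<^sub>v 0}" "{0\<^sub>v 0}" _ "0\<^sub>v 0"]) (auto intro!: L_free_singleton)
next
  case (insert e E)
  then have "has_triple n A (w + w * card E) (\<Phi> e \<union> (\<Union>e\<in>E. \<Phi> e))"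
    by (intro has_triple_Un) auto
  then show ?case using insert by simp
qed

lemma has_triple_mono: "has_triple n A m \<Phi> \<Longrightarrow> \<Psi> \<subseteq> \<Phi> \<Longrightarrow> has_triple n A m \<Psi>"
  unfolding has_triple_def by blast

text \<open>A triple can be enlarged to more copies by taking products with \<open>A\<close>.\<close>

lemma has_triple_pad:
  assumes "L_free n s c A" "finite A" "has_triple n A m \<Phi>" "m \<le> d"
  shows "has_triple n A d \<Phi>"
proof -
  have "has_triple n A 1 {}"
    by (rule has_tripleI[of _ _ A A _ "0\<^sub>v n"]) (use assms in auto)
  then have "has_triple n A (1 * card {..<d - m}) (\<Union>e\<in>{..<d - m}. {})"
    by (intro has_triple_UNION) auto
  then have "has_triple n A (m + (d - m)) (\<Phi> \<union> {})"
    using assms(3) by (intro has_triple_Un) auto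
  then show ?thesis using assms(4) by simp
qed

subsection \<open>One copy of the space: several entries equal to the special point\<close>

text \<open>If \<open>A\<close> is empty or a singleton and \<open>v \<notin> A\<close>, every entry other than \<open>v\<close> is the same point \<open>a\<close>, and
  the form takes the value \<open>(\<Sum>i\<in>I. c i) (v - a) \<noteq> 0\<close>.\<close>

lemma has_triple_card_le_1:
  assumes A: "L_free n s c A" "finite A" "card A \<le> 1" and n: "n \<ge> 1"
  shows "has_triple n A 1 (patterns s)"
proof -
  have A_eq: "a = b" if "a \<in> A" "b \<in> A" for a b
    using A that by (auto simp: card_le_Suc0_iff_eq)
  have "vec n (\<lambda>_. 0) \<noteq> vec n (\<lambda>_. 1 :: 'a)"
  proof
    assume "vec n (\<lambda>_. 0) = vec n (\<lambda>_. 1 :: 'a)"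
    then have "vec n (\<lambda>_. 0) $ 0 = vec n (\<lambda>_. 1 :: 'a) $ 0" by simp
    then show False using n by simp
  qed
  then obtain v :: "'a vec" where v: "v \<in> carrier_vec n" "v \<notin> A"
    using A_eq by (metis vec_carrier)
  have "avoids n s c (slots A A v I K)" if IK: "(I, K) \<in> patterns s" for I K
    unfolding avoids_def
  proof (intro allI impI notI)
    fix x assume x: "\<forall>i\<in>{1..s}. x i \<in> slots A A v I K i" and L: "lin_form n s c x = 0\<^sub>v n"
    have I: "I \<subset> {1..s}" "I \<noteq> {}"
      using IK s_ge_3 by (auto simp: patterns_def)
    have "\<exists>j. j \<in> {1..s} - I" using I by blast
    then obtain j where j: "j \<in> {1..s}" "j \<notin> I" by blast
    define a where "a = x j"
    have a: "a \<in> A" using bspec[OF x j(1)] j by (simp add: a_def slots_def)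
    then have ac: "a \<in> carrier_vec n" using L_free_carrier[OF A(1)] by blast
    have xI: "x i = v" if "i \<in> I" for i
      using bspec[OF x, of i] that I by (auto simp: slots_def)
    have xJ: "x i = a" if "i \<in> {1..s} - I" for i
      using bspec[OF x, of i] that A_eq[OF _ a] by (auto simp: slots_def)
    have xc: "x i \<in> carrier_vec n" if "i \<in> {1..s}" for i
      using xI[of i] xJ[of i] v ac that by (cases "i \<in> I") auto
    have split: "(\<Sum>i\<in>{1..s}. f i) = (\<Sum>i\<in>{1..s} - I. f i) + (\<Sum>i\<in>I. f i)" for f :: "nat \<Rightarrow> 'a"
      using I by (intro sum.subset_diff) auto
    have cJ: "(\<Sum>i\<in>{1..s} - I. c i) = - (\<Sum>i\<in>I. c i)"
      using split[of c] unfolding sum_coeff by (simp add: eq_neg_iff_add_eq_0)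
    have "v $ l = a $ l" if l: "l < n" for l
    proof -
      have "0 = (\<Sum>i\<in>{1..s}. c i * x i $ l)"
        using L lin_form_eq_0_iff[of s x n c] xc l by metis
      also have "\<dots> = (\<Sum>i\<in>{1..s} - I. c i) * a $ l + (\<Sum>i\<in>I. c i) * v $ l"
        unfolding split sum_distrib_right by (intro arg_cong2[of _ _ _ _ "(+)"] sum.cong refl) (simp_all only: xI xJ)
      also have "\<dots> = (\<Sum>i\<in>I. c i) * (v $ l - a $ l)"
        unfolding cJ by (simp add: algebra_simps)
      finally show ?thesis using sum_coeff_nonzero[OF I] by simp
    qed
    then have "v = a" using v ac by (intro eq_vecI) auto
    then show False using a v by simp
  qed
  then show ?thesis
    using A v by (intro has_tripleI[of _ _ A A _ v]) auto
qed

text \<open>If \<open>v\<close> is the weighted mean, with weights \<open>c i\<close>, over \<open>I\<close> of a non-constant assignment \<open>b\<close> of elements of \<open>A\<close>,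
  a solution equal to \<open>v\<close> on \<open>I\<close> yields one in \<open>A\<close> that equals \<open>b\<close> on \<open>I\<close>. Below \<open>b\<close> is \<open>a1\<close>
  at one index and \<open>a0\<close> at the others.\<close>

lemma has_triple_many_special:
  assumes A: "L_free n s c A" "finite A" and a: "a0 \<in> A" "a1 \<in> A" "a0 \<noteq> a1"
    and I: "I \<subseteq> {1..s}" "2 \<le> card I" "card I < s"
  shows "has_triple n A 1 ({I} \<times> UNIV)"
proof -
  have "finite I" using I(1) finite_subset by blast
  then obtain p q where pq: "p \<in> I" "q \<in> I" "p \<noteq> q"
    using I(2) card_le_Suc0_iff_eq[of I] by force
  have "I \<subset> {1..s}" "I \<noteq> {}" using I pq by auto
  then have cI: "(\<Sum>i\<in>I. c i) \<noteq> 0" by (rule sum_coeff_nonzero)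
  note Ac = subsetD[OF L_free_carrier[OF A(1)]]
  define v where "v = a0 + (c p / (\<Sum>i\<in>I. c i)) \<cdot>\<^sub>v (a1 - a0)"
  have v: "v \<in> carrier_vec n" using Ac a by (auto simp: v_def)
  have "avoids n s c (slots A A v I K)" for K
    unfolding avoids_def
  proof (intro allI impI notI)
    fix x assume x: "\<forall>i\<in>{1..s}. x i \<in> slots A A v I K i" and L: "lin_form n s c x = 0\<^sub>v n"
    define z where "z i = (if i = p then a1 else if i \<in> I then a0 else x i)" for i
    have zA: "z i \<in> A" if "i \<in> {1..s}" for i
      using bspec[OF x that] a pq by (auto simp: z_def slots_def split: if_splits)
    have xI: "x i = v" if "i \<in> I" for i
      using bspec[OF x, of i] that I by (auto simp: slots_def)
    have xc: "x i \<in> carrier_vec n" if "i \<in> {1..s}" for i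
      using bspec[OF x that] v Ac by (auto simp: slots_def split: if_splits)
    have split: "(\<Sum>i\<in>{1..s}. f i) = (\<Sum>i\<in>{1..s} - I. f i) + (\<Sum>i\<in>I. f i)" for f :: "nat \<Rightarrow> 'a"
      using I by (intro sum.subset_diff) auto
    have remove: "(\<Sum>i\<in>I. f i) = f p + (\<Sum>i\<in>I - {p}. f i)" for f :: "nat \<Rightarrow> 'a"
      using pq \<open>finite I\<close> by (intro sum.remove) auto
    have zc: "z i \<in> carrier_vec n" if "i \<in> {1..s}" for i
      by (rule Ac[OF zA[OF that]])
    have eq: "(\<Sum>i\<in>{1..s}. c i * z i $ l) = (\<Sum>i\<in>{1..s}. c i * x i $ l)" if l: "l < n" for l
    proof -
      have dim: "dim_vec a0 = n" "dim_vec a1 = n"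
        using Ac a by (auto intro: carrier_vecD)
      have "(\<Sum>i\<in>I. c i * x i $ l) = (\<Sum>i\<in>I. c i) * v $ l"
        unfolding sum_distrib_right by (intro sum.cong refl) (simp only: xI)
      also have "v $ l = a0 $ l + (c p / (\<Sum>i\<in>I. c i)) * (a1 $ l - a0 $ l)"
        using l dim by (simp add: v_def)
      also have "(\<Sum>i\<in>I. c i) * \<dots> = (\<Sum>i\<in>I. c i) * a0 $ l + c p * (a1 $ l - a0 $ l)"
        using cI by (simp add: field_simps)
      also have "\<dots> = c p * a1 $ l + (\<Sum>i\<in>I - {p}. c i) * a0 $ l"
        by (subst remove) (simp add: algebra_simps)
      also have "\<dots> = (\<Sum>i\<in>I. c i * z i $ l)"
        unfolding remove sum_distrib_right
        by (intro arg_cong2[of _ _ _ _ "(+)"] sum.cong refl) (simp_all add: z_def)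
      finally have "(\<Sum>i\<in>I. c i * z i $ l) = (\<Sum>i\<in>I. c i * x i $ l)" ..
      moreover have "(\<Sum>i\<in>{1..s} - I. c i * z i $ l) = (\<Sum>i\<in>{1..s} - I. c i * x i $ l)"
        using pq by (intro sum.cong refl) (auto simp: z_def)
      ultimately show ?thesis unfolding split by (simp only:)
    qed
    have "lin_form n s c z = 0\<^sub>v n"
      by (rule iffD2[OF lin_form_eq_0_cong L]) (fact zc, fact xc, fact eq)
    from L_freeD[OF A(1) zA this, of p q] have "z p = z q" using pq I by blast
    then show False using pq a by (simp add: z_def)
  qed
  then show ?thesis
    using A v by (intro has_tripleI[of _ _ A A _ v]) auto
qed

subsection \<open>Two copies of the space: one entry equal to the special point\<close>

lemma lin_form_add_const:
  assumes x: "\<And>i. i \<in> {1..s} \<Longrightarrow> x i \<in> carrier_vec N" and u: "u \<in> carrier_vec N"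
    and y: "\<And>i. i \<in> {1..s} \<Longrightarrow> y i = x i + u"
    and L: "lin_form N s c y = 0\<^sub>v N"
  shows "lin_form N s c x = 0\<^sub>v N"
proof -
  have yc: "y i \<in> carrier_vec N" if "i \<in> {1..s}" for i
    unfolding y[OF that] using x[OF that] u by simp
  have eq: "(\<Sum>i\<in>{1..s}. c i * x i $ l) = (\<Sum>i\<in>{1..s}. c i * y i $ l)" if l: "l < N" for l
  proof -
    have "(\<Sum>i\<in>{1..s}. c i * y i $ l) = (\<Sum>i\<in>{1..s}. c i * x i $ l + c i * u $ l)"
      using l u by (intro sum.cong refl) (auto simp: y algebra_simps)
    also have "\<dots> = (\<Sum>i\<in>{1..s}. c i * x i $ l) + (\<Sum>i\<in>{1..s}. c i) * u $ l"
      by (simp only: sum.distrib sum_distrib_right)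
    finally show ?thesis by (simp only: sum_coeff mult_zero_left add_0_right)
  qed
  show ?thesis
    by (rule iffD2[OF lin_form_eq_0_cong L]) (fact x, fact yc, fact eq)
qed

text \<open>The reason why a shear of a product of L-free sets is L-free: the unsheared coordinates of a solution are
  all equal, so the shear moves the other coordinates by a common translation.\<close>

lemma shear_solution_const:
  assumes A: "L_free N s c A" and A': "L_free M s c A'"
    and g: "\<And>x. x \<in> A \<Longrightarrow> g x \<in> carrier_vec M"
    and y: "\<And>i. i \<in> {1..s} \<Longrightarrow> y i \<in> A" and z: "\<And>i. i \<in> {1..s} \<Longrightarrow> z i \<in> A'"
    and L: "lin_form N s c y = 0\<^sub>v N" "lin_form M s c (\<lambda>i. z i + g (y i)) = 0\<^sub>v M"
    and ij: "i \<in> {1..s}" "j \<in> {1..s}"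
  shows "y i = y j" "z i = z j"
proof -
  have y_const: "y k = y i" if "k \<in> {1..s}" for k
    by (rule L_freeD[OF A y L(1) that ij(1)])
  from y_const[OF ij(2)] show "y i = y j" by (rule sym)
  have "lin_form M s c z = 0\<^sub>v M"
    by (rule lin_form_add_const[OF _ g[OF y[OF ij(1)]] _ L(2)])
      (use z L_free_carrier[OF A'] y_const in auto)
  from L_freeD[OF A' z this ij] show "z i = z j" .
qed

text \<open>The images of \<open>A \<times> A\<close> under the maps \<open>(x, y) \<mapsto> (x, y + g x)\<close> and \<open>(x, y) \<mapsto> (x + g y, y)\<close>.\<close>

definition shear_right :: "('a vec \<Rightarrow> 'a vec) \<Rightarrow> 'a vec set \<Rightarrow> 'a vec set" where
  "shear_right g A = (\<lambda>(x, y). x @\<^sub>v (y + g x)) ` (A \<times> A)"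

definition shear_left :: "('a vec \<Rightarrow> 'a vec) \<Rightarrow> 'a vec set \<Rightarrow> 'a vec set" where
  "shear_left g A = (\<lambda>(x, y). (x + g y) @\<^sub>v y) ` (A \<times> A)"

lemma vec_add_right_cancel:
  fixes x y u :: "'a vec"
  assumes "x \<in> carrier_vec N" "y \<in> carrier_vec N" "u \<in> carrier_vec N" "x + u = y + u"
  shows "x = y"
proof (rule eq_vecI)
  fix l assume "l < dim_vec y"
  then have "(x + u) $ l = x $ l + u $ l" "(y + u) $ l = y $ l + u $ l" using assms(1-3) by auto
  then show "x $ l = y $ l" unfolding assms(4) by simp
qed (use assms in auto)

lemma card_shear:
  assumes A: "A \<subseteq> carrier_vec n" and g: "\<And>x. x \<in> A \<Longrightarrow> g x \<in> carrier_vec n"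
  shows "card (shear_right g A) = card A ^ 2" "card (shear_left g A) = card A ^ 2"
proof -
  have "inj_on (\<lambda>(x, y). x @\<^sub>v (y + g x)) (A \<times> A)"
  proof (rule inj_onI, clarify)
    fix x y x' y' assume *: "x \<in> A" "y \<in> A" "x' \<in> A" "y' \<in> A" "x @\<^sub>v (y + g x) = x' @\<^sub>v (y' + g x')"
    then have "x = x' \<and> y + g x = y' + g x'"
      using append_vec_eq[of x n x'] A by blast
    then show "x = x' \<and> y = y'"
      using vec_add_right_cancel[of y n y' "g x"] * A g by auto
  qed
  then show "card (shear_right g A) = card A ^ 2"
    by (simp add: shear_right_def card_image card_cartesian_product power2_eq_square)
  have "inj_on (\<lambda>(x, y). (x + g y) @\<^sub>v y) (A \<times> A)"
  proof (rule inj_onI, clarify)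
    fix x y x' y' assume *: "x \<in> A" "y \<in> A" "x' \<in> A" "y' \<in> A" "(x + g y) @\<^sub>v y = (x' + g y') @\<^sub>v y'"
    have "x + g y \<in> carrier_vec n" "x' + g y' \<in> carrier_vec n"
      using * A g[of y] g[of y'] by auto
    then have "x + g y = x' + g y' \<and> y = y'"
      using append_vec_eq[of "x + g y" n "x' + g y'"] * by blast
    then show "x = x' \<and> y = y'"
      using vec_add_right_cancel[of x n x' "g y"] * A g by auto
  qed
  then show "card (shear_left g A) = card A ^ 2"
    by (simp add: shear_left_def card_image card_cartesian_product power2_eq_square)
qed

lemma L_free_shear_right:
  assumes A: "L_free n s c A" and g: "\<And>x. x \<in> A \<Longrightarrow> g x \<in> carrier_vec n"
  shows "L_free (n + n) s c (shear_right g A)"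
proof (rule L_freeI)
  note Ac = subsetD[OF L_free_carrier[OF A]]
  show "shear_right g A \<subseteq> carrier_vec (n + n)"
    using Ac g by (auto simp: shear_right_def)
  fix x i j
  assume x: "\<forall>i\<in>{1..s}. x i \<in> shear_right g A" and L: "lin_form (n + n) s c x = 0\<^sub>v (n + n)"
    and ij: "i \<in> {1..s}" "j \<in> {1..s}"
  have "\<forall>i\<in>{1..s}. \<exists>p. fst p \<in> A \<and> snd p \<in> A \<and> x i = fst p @\<^sub>v (snd p + g (fst p))"
    using x by (force simp: shear_right_def)
  then obtain f where
    f: "\<forall>i\<in>{1..s}. fst (f i) \<in> A \<and> snd (f i) \<in> A \<and> x i = fst (f i) @\<^sub>v (snd (f i) + g (fst (f i)))"
    using bchoice[of "{1..s}" "\<lambda>i p. fst p \<in> A \<and> snd p \<in> A \<and> x i = fst p @\<^sub>v (snd p + g (fst p))"]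
    by blast
  define y where "y = (\<lambda>i. fst (f i))"
  define z where "z = (\<lambda>i. snd (f i))"
  have yz: "y i \<in> A" "z i \<in> A" "x i = y i @\<^sub>v (z i + g (y i))" if "i \<in> {1..s}" for i
    using bspec[OF f that] by (simp_all add: y_def z_def)
  have zgc: "z i + g (y i) \<in> carrier_vec n" if "i \<in> {1..s}" for i
    using Ac[OF yz(2)[OF that]] g[OF yz(1)[OF that]] by simp
  note L' = lin_form_append_eq_0D[OF Ac[OF yz(1)] zgc yz(3) L]
  from shear_solution_const[OF A A g yz(1,2) L' ij] show "x i = x j"
    by (simp only: yz(3)[OF ij(1)] yz(3)[OF ij(2)])
qed

lemma L_free_shear_left:
  assumes A: "L_free n s c A" and g: "\<And>x. x \<in> A \<Longrightarrow> g x \<in> carrier_vec n"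
  shows "L_free (n + n) s c (shear_left g A)"
proof (rule L_freeI)
  note Ac = subsetD[OF L_free_carrier[OF A]]
  show "shear_left g A \<subseteq> carrier_vec (n + n)"
    using Ac g by (auto simp: shear_left_def)
  fix x i j
  assume x: "\<forall>i\<in>{1..s}. x i \<in> shear_left g A" and L: "lin_form (n + n) s c x = 0\<^sub>v (n + n)"
    and ij: "i \<in> {1..s}" "j \<in> {1..s}"
  have "\<forall>i\<in>{1..s}. \<exists>p. fst p \<in> A \<and> snd p \<in> A \<and> x i = (fst p + g (snd p)) @\<^sub>v snd p"
    using x by (force simp: shear_left_def)
  then obtain f where
    f: "\<forall>i\<in>{1..s}. fst (f i) \<in> A \<and> snd (f i) \<in> A \<and> x i = (fst (f i) + g (snd (f i))) @\<^sub>v snd (f i)"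
    using bchoice[of "{1..s}" "\<lambda>i p. fst p \<in> A \<and> snd p \<in> A \<and> x i = (fst p + g (snd p)) @\<^sub>v snd p"]
    by blast
  define y where "y = (\<lambda>i. fst (f i))"
  define z where "z = (\<lambda>i. snd (f i))"
  have yz: "y i \<in> A" "z i \<in> A" "x i = (y i + g (z i)) @\<^sub>v z i" if "i \<in> {1..s}" for i
    using bspec[OF f that] by (simp_all add: y_def z_def)
  have ygc: "y i + g (z i) \<in> carrier_vec n" if "i \<in> {1..s}" for i
    using Ac[OF yz(1)[OF that]] g[OF yz(2)[OF that]] by simp
  note L' = lin_form_append_eq_0D[OF ygc Ac[OF yz(2)] yz(3) L]
  from shear_solution_const[OF A A g yz(2,1) L'(2,1) ij] show "x i = x j"
    by (simp only: yz(3)[OF ij(1)] yz(3)[OF ij(2)])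
qed

text \<open>In a solution fitting the pattern, the first coordinates come from a solution in \<open>A\<close> with
  \<open>e (z k)\<close> at index \<open>i\<close>, so they all equal \<open>e (z k)\<close>; then the second coordinates come from a solution in
  \<open>A\<close> with \<open>e (z k)\<close> at index \<open>i\<close> as well, whence \<open>z k = e (z k)\<close>. But \<open>e\<close> has no fixed point.\<close>

lemma has_triple_one_special:
  assumes A: "L_free n s c A" "finite A" and a: "a0 \<in> A" "a1 \<in> A" "a0 \<noteq> a1"
    and ik: "i \<in> {1..s}" "k \<in> {1..s}" "i \<noteq> k"
  shows "has_triple n A 2 {({i}, {k})}"
proof -
  note Ac = subsetD[OF L_free_carrier[OF A(1)]]
  define J where "J = {1..s} - {i} - {k}"
  have split: "(\<Sum>j\<in>{1..s}. f j) = f i + (f k + (\<Sum>j\<in>J. f j))" for f :: "nat \<Rightarrow> 'a"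
  proof -
    have "(\<Sum>j\<in>{1..s}. f j) = f i + (\<Sum>j\<in>{1..s} - {i}. f j)"
      using ik by (intro sum.remove) auto
    also have "(\<Sum>j\<in>{1..s} - {i}. f j) = f k + (\<Sum>j\<in>J. f j)"
      unfolding J_def using ik by (intro sum.remove) auto
    finally show ?thesis .
  qed
  have "card J = s - 2" using ik by (simp add: J_def)
  then have "J \<noteq> {}" using s_ge_3 by auto
  moreover have "J \<subset> {1..s}" unfolding J_def using ik(1) by blast
  ultimately have cJ: "(\<Sum>j\<in>J. c j) \<noteq> 0" by (intro sum_coeff_nonzero)
  have ck: "c k \<noteq> 0" by (rule coeff_nonzero[OF ik(2)])
  define e where "e y = (if y = a0 then a1 else a0)" for y
  have e: "e y \<in> A" "e y \<noteq> y" for y using a by (auto simp: e_def)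
  \<comment> \<open>The scalars are chosen so that, once the entries with indices in \<open>J\<close> (for \<open>g\<close>) or with
    index \<open>k\<close> (for \<open>h\<close>) are inserted into the form, the shears contribute \<open>c i\<close> times an element of
    \<open>A\<close>, replacing the entry \<open>0\<close> of \<open>v\<close> at index \<open>i\<close>.\<close>
  define g where "g x = (c i / (\<Sum>j\<in>J. c j)) \<cdot>\<^sub>v x" for x
  define h where "h y = (c i / c k) \<cdot>\<^sub>v e y" for y
  have g: "g x \<in> carrier_vec n" if "x \<in> A" for x using Ac[OF that] by (simp add: g_def)
  have h: "h x \<in> carrier_vec n" for x using Ac[OF e(1)] by (simp add: h_def)
  define v :: "'a vec" where "v = 0\<^sub>v n @\<^sub>v 0\<^sub>v n"
  have "avoids (n + n) s c (slots (shear_right g A) (shear_left h A) v {i} {k})"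
    unfolding avoids_def
  proof (intro allI impI notI)
    fix x
    assume x: "\<forall>j\<in>{1..s}. x j \<in> slots (shear_right g A) (shear_left h A) v {i} {k} j"
      and L: "lin_form (n + n) s c x = 0\<^sub>v (n + n)"
    have xi: "x i = 0\<^sub>v n @\<^sub>v 0\<^sub>v n"
      using bspec[OF x ik(1)] by (simp add: slots_def v_def)
    have "x k \<in> shear_left h A"
      using bspec[OF x ik(2)] ik by (simp add: slots_def)
    then obtain yk zk where k: "yk \<in> A" "zk \<in> A" "x k = (yk + h zk) @\<^sub>v zk"
      by (auto simp: shear_left_def)
    have "\<forall>j\<in>J. \<exists>p. fst p \<in> A \<and> snd p \<in> A \<and> x j = fst p @\<^sub>v (snd p + g (fst p))"
    proof
      fix j assume "j \<in> J"
      then have "x j \<in> shear_right g A"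
        using bspec[OF x, of j] by (auto simp: slots_def J_def)
      then show "\<exists>p. fst p \<in> A \<and> snd p \<in> A \<and> x j = fst p @\<^sub>v (snd p + g (fst p))"
        by (force simp: shear_right_def)
    qed
    then obtain f where
      f: "\<forall>j\<in>J. fst (f j) \<in> A \<and> snd (f j) \<in> A \<and> x j = fst (f j) @\<^sub>v (snd (f j) + g (fst (f j)))"
      using bchoice[of J "\<lambda>j p. fst p \<in> A \<and> snd p \<in> A \<and> x j = fst p @\<^sub>v (snd p + g (fst p))"]
      by blast
    define E where "E = e zk"
    define P where "P j = (if j = i then 0\<^sub>v n else if j = k then yk + h zk else fst (f j))" for j
    define Q where "Q j = (if j = i then 0\<^sub>v n else if j = k then zk else snd (f j) + g (fst (f j)))" for j
    define y where "y j = (if j = i then E else if j = k then yk else fst (f j))" for j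
    define z where "z j = (if j = i then E else if j = k then zk else snd (f j))" for j
    have inJ: "j \<in> J" if "j \<in> {1..s}" "j \<noteq> i" "j \<noteq> k" for j
      using that by (simp add: J_def)
    have notJ: "j \<noteq> i" "j \<noteq> k" if "j \<in> J" for j
      using that by (simp_all add: J_def)
    have EA: "E \<in> A" by (simp add: E_def e)
    have yA: "y j \<in> A" and zA: "z j \<in> A" if "j \<in> {1..s}" for j
      using inJ[OF that] f EA k by (auto simp: y_def z_def)
    have yc: "y j \<in> carrier_vec n" and zc: "z j \<in> carrier_vec n" if "j \<in> {1..s}" for j
      by (rule Ac[OF yA[OF that]], rule Ac[OF zA[OF that]])
    have Pc: "P j \<in> carrier_vec n" and Qc: "Q j \<in> carrier_vec n" and xPQ: "x j = P j @\<^sub>v Q j"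
      if "j \<in> {1..s}" for j
      using inJ[OF that] f k xi Ac g h by (auto simp: P_def Q_def)
    note LPQ = lin_form_append_eq_0D[OF Pc Qc xPQ L]
    have dimA: "dim_vec u = n" if "u \<in> A" for u
      using Ac[OF that] by (rule carrier_vecD)
    have y_eq: "(\<Sum>j\<in>{1..s}. c j * y j $ l) = (\<Sum>j\<in>{1..s}. c j * P j $ l)" if l: "l < n" for l
    proof -
      have "(\<Sum>j\<in>J. c j * y j $ l) = (\<Sum>j\<in>J. c j * P j $ l)"
        by (intro sum.cong refl) (simp add: y_def P_def notJ)
      moreover have "c k * P k $ l = c k * yk $ l + c i * E $ l"
        using ik l ck dimA[OF EA] by (simp add: P_def h_def E_def field_simps)
      ultimately show ?thesis
        unfolding split using ik l by (simp add: y_def P_def)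
    qed
    have "lin_form n s c y = 0\<^sub>v n"
      by (rule iffD2[OF lin_form_eq_0_cong LPQ(1)]) (fact yc, fact Pc, fact y_eq)
    from L_freeD[OF A(1) yA this _ ik(1)] have y_const: "y j = E" if "j \<in> {1..s}" for j
      using that by (simp add: y_def)
    have fst_f: "fst (f j) = E" if "j \<in> J" for j
      using y_const[of j] that notJ[OF that] by (simp add: y_def J_def)
    have z_eq: "(\<Sum>j\<in>{1..s}. c j * z j $ l) = (\<Sum>j\<in>{1..s}. c j * Q j $ l)" if l: "l < n" for l
    proof -
      have "(\<Sum>j\<in>J. c j * Q j $ l) = (\<Sum>j\<in>J. c j * z j $ l + c j * g E $ l)"
      proof (intro sum.cong refl)
        fix j assume j: "j \<in> J"
        have "dim_vec (g E) = n" using g[OF EA] by (rule carrier_vecD)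
        then show "c j * Q j $ l = c j * z j $ l + c j * g E $ l"
          using notJ[OF j] fst_f[OF j] l by (simp add: Q_def z_def distrib_left)
      qed
      also have "\<dots> = (\<Sum>j\<in>J. c j * z j $ l) + (\<Sum>j\<in>J. c j) * g E $ l"
        by (simp only: sum.distrib sum_distrib_right)
      also have "(\<Sum>j\<in>J. c j) * g E $ l = c i * E $ l"
        using cJ l dimA[OF EA] by (simp add: g_def)
      finally show ?thesis
        unfolding split using ik l by (simp add: z_def Q_def)
    qed
    have "lin_form n s c z = 0\<^sub>v n"
      by (rule iffD2[OF lin_form_eq_0_cong LPQ(2)]) (fact zc, fact Qc, fact z_eq)
    from L_freeD[OF A(1) zA this ik(1,2)] have "E = zk"
      using ik by (simp add: z_def)
    then show False using e(2)[of zk] by (simp add: E_def)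
  qed
  then show ?thesis
    using card_shear[of A n g] card_shear[of A n h] L_free_shear_right[OF A(1) g]
      L_free_shear_left[OF A(1) h] L_free_carrier[OF A(1)] g h A(2)
    by (intro has_tripleI[of _ _ "shear_right g A" "shear_left h A" _ v])
      (auto simp: v_def mult_2 shear_right_def shear_left_def)
qed

subsection \<open>All patterns\<close>

lemma card_special_sets:
  "card {I. I \<subseteq> {1..s} \<and> 2 \<le> card I \<and> card I < s} = 2 ^ s - s - 2"
proof -
  let ?X = "insert {} (insert {1..s} ((\<lambda>i. {i}) ` {1..s}))"
  have "{I. I \<subseteq> {1..s} \<and> 2 \<le> card I \<and> card I < s} = Pow {1..s} - ?X"
  proof (intro equalityI subsetI)
    fix I assume "I \<in> {I. I \<subseteq> {1..s} \<and> 2 \<le> card I \<and> card I < s}"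
    then show "I \<in> Pow {1..s} - ?X" by auto
  next
    fix I assume I: "I \<in> Pow {1..s} - ?X"
    then have "finite I" using finite_subset by auto
    then have "card I \<noteq> 0" using I by auto
    moreover have "card I \<noteq> 1" using I by (auto simp: card_1_singleton_iff)
    moreover have "card I < s" using I psubset_card_mono[of "{1..s}" I] by auto
    ultimately show "I \<in> {I. I \<subseteq> {1..s} \<and> 2 \<le> card I \<and> card I < s}" using I by auto
  qed
  moreover have "card ?X = s + 2"
  proof -
    have "{1..s} \<notin> (\<lambda>i. {i}) ` {1..s}"
    proof
      assume "{1..s} \<in> (\<lambda>i. {i}) ` {1..s}"
      then have "card {1..s} = 1" by auto
      then show False using s_ge_3 by simp
    qed
    moreover have "{} \<notin> insert {1..s} ((\<lambda>i. {i}) ` {1..s})" using s_ge_3 by auto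
    moreover have "card ((\<lambda>i. {i}) ` {1..s}) = s" by (simp add: card_image)
    ultimately show ?thesis by (simp add: card_insert_disjoint)
  qed
  moreover have "?X \<subseteq> Pow {1..s}" by auto
  ultimately show ?thesis by (simp add: card_Diff_subset card_Pow)
qed

lemma two_pow_gt: "s + 2 < 2 ^ s"
  using s_ge_3 by (induction s rule: dec_induct) auto

lemma has_triple_patterns:
  assumes A: "L_free n s c A" "finite A" and n: "n \<ge> 1"
  shows "has_triple n A ((2 ^ s - s - 2) * (1 + 2 * s * (s - 1))) (patterns s)"
proof -
  define M :: nat where "M = 2 ^ s - s - 2"
  have M: "M \<ge> 1" using two_pow_gt by (simp add: M_def)
  show ?thesis
  proof (cases "card A \<le> 1")
    case True
    have "1 \<le> (2 ^ s - s - 2) * (1 + 2 * s * (s - 1))"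
      using M by (simp add: M_def)
    then show ?thesis
      by (intro has_triple_pad[OF A has_triple_card_le_1[OF A True n]])
  next
    case False
    then obtain a0 a1 where a: "a0 \<in> A" "a1 \<in> A" "a0 \<noteq> a1"
      using A(2) card_le_Suc0_iff_eq[of A] by auto
    define E where "E = {I. I \<subseteq> {1..s} \<and> 2 \<le> card I \<and> card I < s}"
    define F where "F = (SIGMA i:{1..s}. {1..s} - {i})"
    have "finite E" unfolding E_def by (rule finite_subset[of _ "Pow {1..s}"]) auto
    then have "has_triple n A (1 * card E) (\<Union>I\<in>E. {I} \<times> UNIV)"
      by (intro has_triple_UNION has_triple_many_special[OF A a]) (auto simp: E_def)
    moreover have "has_triple n A (2 * card F) (\<Union>p\<in>F. {({fst p}, {snd p})})"
      by (intro has_triple_UNION has_triple_one_special[OF A a]) (auto simp: F_def)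
    ultimately have "has_triple n A (1 * card E + 2 * card F)
        ((\<Union>I\<in>E. {I} \<times> UNIV) \<union> (\<Union>p\<in>F. {({fst p}, {snd p})}))"
      by (rule has_triple_Un)
    moreover have "patterns s \<subseteq> (\<Union>I\<in>E. {I} \<times> UNIV) \<union> (\<Union>p\<in>F. {({fst p}, {snd p})})"
      by (auto simp: patterns_def E_def F_def)
    ultimately have *: "has_triple n A (1 * card E + 2 * card F) (patterns s)"
      by (rule has_triple_mono)
    have "card E = M" unfolding E_def M_def by (rule card_special_sets)
    moreover have "card F = s * (s - 1)" by (simp add: F_def)
    moreover have "2 * (s * (s - 1)) \<le> M * (2 * (s * (s - 1)))" using M by simp
    ultimately have "1 * card E + 2 * card F \<le> M * (1 + 2 * s * (s - 1))"
      by (simp add: distrib_left mult.assoc)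
    then show ?thesis
      using has_triple_pad[OF A *] by (simp only: M_def)
  qed
qed

end

section \<open>The product construction\<close>

lemma finite_carrier_vec: "finite (carrier_vec n :: 'a::finite vec set)"
proof (rule finite_subset)
  show "carrier_vec n \<subseteq> vec_of_list ` {xs :: 'a list. set xs \<subseteq> UNIV \<and> length xs = n}"
  proof
    fix v :: "'a vec" assume "v \<in> carrier_vec n"
    then have "v = vec_of_list (list_of_vec v)" "length (list_of_vec v) = n"
      by (simp_all add: vec_list)
    then show "v \<in> vec_of_list ` {xs. set xs \<subseteq> UNIV \<and> length xs = n}" by blast
  qed
  show "finite (vec_of_list ` {xs :: 'a list. set xs \<subseteq> UNIV \<and> length xs = n})"
    by (intro finite_imageI finite_lists_length_eq) simp
qed

theorem theorem1p3:
  fixes s n d :: nat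
    and c :: "nat \<Rightarrow> 'a::{field, finite}"
    and A :: "'a vec set"
  assumes "s \<ge> 3"
    and "\<forall>i\<in>{1..s}. c i \<noteq> 0"
    and "translation_invariant s c"
    and "genus_one s c"
    and "d = (2 ^ s - s - 2) * (1 + 2 * s * (s - 1))"
    and "n \<ge> 1"
    and "A \<subseteq> carrier_vec n"
    and "L_free n s c A"
  shows "\<forall>r::nat. r \<ge> 1 \<longrightarrow>
    (\<exists>B. B \<subseteq> carrier_vec (d * n * r) \<and> L_free (d * n * r) s c B \<and>
       card B = r * card A ^ (d * (r - 1)))"
proof (intro allI impI)
  fix r :: nat
  interpret genus_one_form s c
    using assms(1-4) by unfold_locales auto
  have "finite A"
    using assms(7) finite_carrier_vec by (rule finite_subset)
  then have "has_triple n A d (patterns s)"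
    unfolding assms(5) using assms(6,8) by (intro has_triple_patterns)
  then obtain T T' v where T: "L_free (d * n) s c T" "L_free (d * n) s c T'"
    and fin: "finite T" "finite T'" and card: "card T = card A ^ d" "card T' = card A ^ d"
    and v: "v \<in> carrier_vec (d * n)"
    and excl: "\<And>I K. (I, K) \<in> patterns s \<Longrightarrow> avoids (d * n) s c (slots T T' v I K)"
    by (rule has_tripleE) blast
  interpret special_triple s c "d * n" T T' v
    by unfold_locales (use T v excl in auto)
  have "L_free (d * n * r) s c (words T T' v r)"
    using L_free_words[of r] by (simp only: mult.commute)
  moreover have "card (words T T' v r) = r * card A ^ (d * (r - 1))"
    unfolding card_words[OF fin card] by (simp only: power_mult)
  ultimately show "\<exists>B. B \<subseteq> carrier_vec (d * n * r) \<and> L_free (d * n * r) s c B \<and>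
      card B = r * card A ^ (d * (r - 1))"
    using L_free_carrier by blast
qed

end
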